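(* Let $d \ge 2$ be an integer, let $R_1, R_2$ be two non-empty families of partitions of $[d]$, and let $c(d)=3^{-2^{d+1}}$. If $R_2 \nprec R_1$, then for every field $\mathbb{F}$ and every positive integer $n$ there exists an order-$d$ tensor $T:[n]^d\to\mathbb{F}$ whose $R_2$-rank is equal to $1$ but whose $R_1$-rank is at least $n^{c(d)}$.
   Context: $[d]=\{1,\dots,d\}$; the parts of a partition are non-empty. $\mathbb{F}$ is an arbitrary field. For positive integers $n_1,\dots,n_d$, an order-$d$ tensor is a function $T:[n_1]\times\dots\times[n_d]\to\mathbb{F}$. For $x\in[n_1]\times\dots\times[n_d]$ and $J\subset[d]$, $x(J)\in\prod_{j\in J}[n_j]$ denotes the restriction of $x$ to its coordinates in $J$. $R$-rank: let $R$ be a non-empty family of partitions of $[d]$. An order-$d$ tensor $T$ has $R$-rank at most $1$ if there exist a partition $P\in R$ and, for each $J\in P$, a function $a_J:\prod_{j\in J}[n_j]\to\mathbb{F}$ such that $T(x)=\prod_{J\in P}a_J(x(J))$ for all $x$. The $R$-rank of $T$ is the smallest nonnegative integer $k$ such that $T=T_1+\dots+T_k$ for some order-$d$ tensors $T_1,\dots,T_k$ each of $R$-rank at most $1$ (the partition used may differ from one $T_i$ to another; the zero tensor has $R$-rank $0$). Finer: for partitions $P_1,P_2$ of $[d]$, $P_2\prec P_1$ ($P_2$ is finer than $P_1$) if for every $J_2\in P_2$ there is $J_1\in P_1$ with $J_2\subset J_1$. For non-empty families $R_1,R_2$ of partitions of $[d]$, $R_2\prec R_1$ if for every $P_2\in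 R_2$ there exists $P_1\in R_1$ with $P_2\prec P_1$; $R_2\nprec R_1$ means that this fails. *)

theory Defs
  imports Complex_Main "HOL-Library.FuncSet" "HOL-Library.Disjoint_Sets"
begin

text \<open>
  Points of \<open>[n\<^sub>1] \<times> \<dots> \<times> [n\<^sub>d]\<close> are extensional functions on \<open>{1..d}\<close>, so the restriction
  \<open>x(J)\<close> is \<open>restrict x J\<close>. A tensor is a function on such points; its values outside
  \<open>index_box d ns\<close> are irrelevant, and all identities between tensors below are required on the box only.
\<close>

definition index_box :: "nat \<Rightarrow> (nat \<Rightarrow> nat) \<Rightarrow> (nat \<Rightarrow> nat) set" where
  "index_box d ns = (\<Pi>\<^sub>E i\<in>{1..d}. {1..ns i})"

type_synonym 'a tensor = "(nat \<Rightarrow> nat) \<Rightarrow> 'a"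

definition partition_family :: "nat \<Rightarrow> nat set set set \<Rightarrow> bool" where
  "partition_family d R \<longleftrightarrow> R \<noteq> {} \<and> (\<forall>P\<in>R. partition_on {1..d} P)"

definition R_rank_le_one ::
    "nat \<Rightarrow> (nat \<Rightarrow> nat) \<Rightarrow> nat set set set \<Rightarrow> 'a::field tensor \<Rightarrow> bool" where
  "R_rank_le_one d ns R T \<longleftrightarrow>
     (\<exists>P\<in>R. \<exists>a :: nat set \<Rightarrow> (nat \<Rightarrow> nat) \<Rightarrow> 'a.
        \<forall>x\<in>index_box d ns. T x = (\<Prod>J\<in>P. a J (restrict x J)))"

definition R_decomposable ::
    "nat \<Rightarrow> (nat \<Rightarrow> nat) \<Rightarrow> nat set set set \<Rightarrow> 'a::field tensor \<Rightarrow> nat \<Rightarrow> bool" where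
  "R_decomposable d ns R T k \<longleftrightarrow>
     (\<exists>S :: nat \<Rightarrow> 'a tensor.
        (\<forall>i<k. R_rank_le_one d ns R (S i)) \<and>
        (\<forall>x\<in>index_box d ns. T x = (\<Sum>i<k. S i x)))"

definition R_rank ::
    "nat \<Rightarrow> (nat \<Rightarrow> nat) \<Rightarrow> nat set set set \<Rightarrow> 'a::field tensor \<Rightarrow> nat" where
  "R_rank d ns R T = (LEAST k. R_decomposable d ns R T k)"

text \<open>The set of such \<open>k\<close> is non-empty, so the \<open>LEAST\<close> above is a genuine minimum.\<close>

lemma R_decomposable_ex:
  fixes T :: "'a::field tensor"
  assumes "d \<ge> 1" "partition_family d R"
  shows "\<exists>k. R_decomposable d ns R T k"
proof -
  from assms obtain P where P: "P \<in> R" "partition_on {1..d} P"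
    by (auto simp: partition_family_def)
  have UP: "\<Union>P = {1..d}" using P(2) by (simp add: partition_on_def)
  have finP: "finite P" using P(2) finite_elements by blast
  obtain J0 where J0: "J0 \<in> P" using UP assms(1) by fastforce
  have fin: "finite (index_box d ns)"
    unfolding index_box_def by (intro finite_PiE) auto
  obtain p where "bij_betw p {0..<card (index_box d ns)} (index_box d ns)"
    using ex_bij_betw_nat_finite[OF fin] by blast
  then have p: "bij_betw p {..<card (index_box d ns)} (index_box d ns)"
    by (simp add: atLeast0LessThan)
  define S where "S i x = (if x = p i then T x else 0)" for i x
  have "R_rank_le_one d ns R (S i)" if i: "i < card (index_box d ns)" for i
  proof -
    define a where "a J y = (if y = restrict (p i) J
        then (if J = J0 then T (p i) else 1) else 0)" for J y
    have "S i x = (\<Prod>J\<in>P. a J (restrict x J))" if x: "x \<in> index_box d ns" for x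
    proof (cases "x = p i")
      case True
      have "(\<Prod>J\<in>P. a J (restrict x J)) = (\<Prod>J\<in>P. if J = J0 then T (p i) else 1)"
        by (simp add: a_def True)
      also have "\<dots> = T (p i)" using finP J0 by (simp add: prod.delta)
      finally show ?thesis by (simp add: S_def True)
    next
      case False
      have pi: "p i \<in> index_box d ns" using p i by (auto simp: bij_betw_def)
      from False x pi obtain j where j: "j \<in> {1..d}" "x j \<noteq> p i j"
        unfolding index_box_def by (meson PiE_ext)
      then obtain J where J: "J \<in> P" "j \<in> J" using UP by blast
      then have "restrict x J \<noteq> restrict (p i) J"
        using j by (metis restrict_apply')
      then have "a J (restrict x J) = 0" by (simp add: a_def)
      then show ?thesis using finP J(1) False by (auto simp: S_def)
    qed
    then show ?thesis using P(1) unfolding R_rank_le_one_def by blast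
  qed
  moreover have "T x = (\<Sum>i<card (index_box d ns). S i x)" if x: "x \<in> index_box d ns" for x
  proof -
    have "(\<Sum>i<card (index_box d ns). S i x)
        = (\<Sum>y\<in>index_box d ns. if x = y then T x else 0)"
      unfolding S_def by (rule sum.reindex_bij_betw[OF p])
    then show ?thesis using fin x by simp
  qed
  ultimately show ?thesis unfolding R_decomposable_def by blast
qed

definition family_finer :: "nat \<Rightarrow> nat set set set \<Rightarrow> nat set set set \<Rightarrow> bool" where
  "family_finer d R2 R1 \<longleftrightarrow> (\<forall>P2\<in>R2. \<exists>P1\<in>R1. refines {1..d} P2 P1)"

end

theory Submission
  imports Defs
begin

text \<open>
  Choose \<open>P \<in> R\<^sub>2\<close> not finer than any partition in \<open>R\<^sub>1\<close>, and let \<open>T\<close> be the product over \<open>J \<in> P\<close> of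
  the tensors \<open>\<delta>\<^sub>J(x) = 1\<close> if \<open>x\<close> is constant on \<open>J\<close> and \<open>0\<close> otherwise. Each \<open>R\<^sub>1\<close>-rank one term is a
  product \<open>f(x(S)) g(x(S\<^sup>c))\<close> where \<open>S\<close> separates some \<open>J \<in> P\<close> into two non-empty pieces. Given \<open>k\<close> such
  terms with \<open>k\<close> small, there is a linear functional vanishing on all of them but not on \<open>T\<close>.
  For a single block this is the slice rank argument for diagonal tensors: contract one coordinate
  with a vector of large support orthogonal to the terms separating that coordinate only. For several
  blocks, restrict the coordinates in different blocks to ranges of very different lengths. The block
  \<open>J\<close> with the longest range is treated by applying the one-block case to all terms that separate
  \<open>J\<close>, for every possible value of the other coordinates at once; contracting \<open>J\<close> leaves the
  remaining terms in product form.
\<close>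

section \<open>Homogeneous linear systems and solutions of large support\<close>

text \<open>Gaussian elimination: an equation with a nonzero coefficient is solved for that
  variable, which uses up one equation and one variable.\<close>

lemma linear_system_nontrivial:
  fixes f :: "'i \<Rightarrow> 'b \<Rightarrow> 'a::field"
  assumes "finite I" "finite A" "card I < card A"
  shows "\<exists>h. (\<exists>a\<in>A. h a \<noteq> 0) \<and> (\<forall>i\<in>I. (\<Sum>a\<in>A. h a * f i a) = 0)"
  using assms
proof (induction I arbitrary: A f rule: finite_induct)
  case empty
  then obtain a where "a \<in> A" by fastforce
  then show ?case by (intro exI[of _ "\<lambda>_. 1"]) auto
next
  case (insert i I)
  show ?case
  proof (cases "\<forall>a\<in>A. f i a = 0")
    case True
    have "card I < card A" using insert by simp
    from insert.IH[OF insert.prems(1) this, of f] obtain h where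
      "\<exists>a\<in>A. h a \<noteq> 0" "\<forall>i\<in>I. (\<Sum>a\<in>A. h a * f i a) = 0" by blast
    with True show ?thesis by (intro exI[of _ h]) auto
  next
    case False
    then obtain a0 where a0: "a0 \<in> A" "f i a0 \<noteq> 0" by blast
    define A' where "A' = A - {a0}"
    have A': "finite A'" "card I < card A'" "A = insert a0 A'" "a0 \<notin> A'"
      using insert a0 by (auto simp: A'_def)
    \<comment> \<open>\<open>f'\<close> is the system with \<open>a0\<close> eliminated by equation
      \<open>i\<close>; equation \<open>i\<close> itself becomes trivial. \<open>g\<close> gives
      \<open>a0\<close> the value that equation \<open>i\<close> forces.\<close>
    define f' where "f' l a = f l a - f l a0 / f i a0 * f i a" for l a
    from insert.IH[OF A'(1,2), of f'] obtain h where
      h: "\<exists>a\<in>A'. h a \<noteq> 0" "\<forall>l\<in>I. (\<Sum>a\<in>A'. h a * f' l a) = 0" by blast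
    define w where "w = (\<Sum>a\<in>A'. h a * f i a)"
    define g where "g = h(a0 := - w / f i a0)"
    have sum_g: "(\<Sum>a\<in>A. g a * f l a) = (\<Sum>a\<in>A'. h a * f' l a)" for l
    proof -
      have "(\<Sum>a\<in>A. g a * f l a) = - w / f i a0 * f l a0 + (\<Sum>a\<in>A'. g a * f l a)"
        using A' by (simp add: g_def)
      also have "(\<Sum>a\<in>A'. g a * f l a) = (\<Sum>a\<in>A'. h a * f l a)"
        using A' by (intro sum.cong) (auto simp: g_def)
      also have "(\<Sum>a\<in>A'. h a * f l a) = (\<Sum>a\<in>A'. h a * f' l a) + f l a0 / f i a0 * w"
        by (simp add: f'_def w_def sum_distrib_left sum.distrib[symmetric] algebra_simps)
      finally show ?thesis by (simp add: algebra_simps)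
    qed
    have "(\<Sum>a\<in>A'. h a * f' i a) = 0" using a0 by (simp add: f'_def)
    moreover have "\<exists>a\<in>A. g a \<noteq> 0" using h(1) A' by (auto simp: g_def)
    ultimately show ?thesis using h(2) sum_g by (intro exI[of _ g]) auto
  qed
qed

text \<open>A solution of maximal support works: if it vanished at more than \<open>card I\<close>
  points, a nontrivial solution supported there could be added and would enlarge the support. This
  supplies the contracting vector of the one-block argument.\<close>

lemma linear_system_large_support:
  fixes f :: "'i \<Rightarrow> 'b \<Rightarrow> 'a::field"
  assumes "finite I" "finite A"
  shows "\<exists>h. card A \<le> card {a \<in> A. h a \<noteq> 0} + card I \<and> (\<forall>i\<in>I. (\<Sum>a\<in>A. h a * f i a) = 0)"
proof -
  define Q where "Q h \<longleftrightarrow> (\<forall>i\<in>I. (\<Sum>a\<in>A. h a * f i a) = 0)" for h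
  define N where "N h = card {a \<in> A. h a \<noteq> 0}" for h :: "'b \<Rightarrow> 'a"
  have "Q (\<lambda>_. 0)" by (simp add: Q_def)
  moreover have "\<forall>h. Q h \<longrightarrow> N h < Suc (card A)"
    using assms(2) by (auto simp: N_def less_Suc_eq_le intro!: card_mono)
  ultimately obtain h where h: "Q h" and max: "\<And>g. Q g \<Longrightarrow> N g \<le> N h"
    using ex_has_greatest_nat[of Q _ N] by blast
  have "card A \<le> N h + card I"
  proof (rule ccontr)
    assume less: "\<not> ?thesis"
    define B where "B = {a \<in> A. h a = 0}"
    have "card A = N h + card B"
    proof -
      have "A = {a \<in> A. h a \<noteq> 0} \<union> B" by (auto simp: B_def)
      moreover have "card ({a \<in> A. h a \<noteq> 0} \<union> B) = N h + card B"
        unfolding N_def using assms(2) by (intro card_Un_disjoint) (auto simp: B_def)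
      ultimately show ?thesis by simp
    qed
    with less have "card I < card B" by simp
    moreover have "finite B" using assms(2) by (simp add: B_def)
    ultimately obtain v where v: "\<exists>a\<in>B. v a \<noteq> 0" "\<forall>i\<in>I. (\<Sum>a\<in>B. v a * f i a) = 0"
      using linear_system_nontrivial[OF assms(1), of B f] by blast
    define g where "g a = h a + (if a \<in> B then v a else 0)" for a
    have "(\<Sum>a\<in>A. g a * f i a) = (\<Sum>a\<in>A. h a * f i a) + (\<Sum>a\<in>B. v a * f i a)" for i
    proof -
      have "(\<Sum>a\<in>A. (if a \<in> B then v a else 0) * f i a) = (\<Sum>a\<in>B. v a * f i a)"
        using assms(2) by (intro sum.mono_neutral_cong_right) (auto simp: B_def)
      then show ?thesis by (simp add: g_def distrib_right sum.distrib)
    qed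
    with h v(2) have "Q g" by (simp add: Q_def)
    obtain b where b: "b \<in> B" "v b \<noteq> 0" using v(1) by blast
    have "{a \<in> A. h a \<noteq> 0} \<subset> {a \<in> A. g a \<noteq> 0}"
    proof
      show "{a \<in> A. h a \<noteq> 0} \<subseteq> {a \<in> A. g a \<noteq> 0}" by (auto simp: g_def B_def)
      have "b \<in> {a \<in> A. g a \<noteq> 0}" "b \<notin> {a \<in> A. h a \<noteq> 0}"
        using b by (auto simp: g_def B_def)
      then show "{a \<in> A. h a \<noteq> 0} \<noteq> {a \<in> A. g a \<noteq> 0}" by blast
    qed
    then have "N h < N g" unfolding N_def using assms(2) by (intro psubset_card_mono) auto
    with max[OF \<open>Q g\<close>] show False by simp
  qed
  with h show ?thesis unfolding Q_def N_def by blast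
qed

section \<open>Functions in product form across a cut of the coordinates\<close>

definition depends_on :: "'i set \<Rightarrow> (('i \<Rightarrow> 'b) \<Rightarrow> 'a) \<Rightarrow> bool" where
  "depends_on S f \<longleftrightarrow> (\<forall>x y. (\<forall>i\<in>S. x i = y i) \<longrightarrow> f x = f y)"

text \<open>Rank at most one for the matrix whose rows are indexed by the coordinates in
  \<open>S\<close> and whose columns by the others.\<close>

definition splits :: "'i set \<Rightarrow> (('i \<Rightarrow> 'b) \<Rightarrow> 'a::comm_semiring_0) \<Rightarrow> bool" where
  "splits S u \<longleftrightarrow> (\<exists>f g. u = (\<lambda>x. f x * g x) \<and> depends_on S f \<and> depends_on (- S) g)"

definition cuts :: "'i set \<Rightarrow> 'i set \<Rightarrow> bool" where
  "cuts S J \<longleftrightarrow> S \<inter> J \<noteq> {} \<and> J - S \<noteq> {}"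

definition diagonal :: "'i set \<Rightarrow> ('i \<Rightarrow> 'b) \<Rightarrow> 'a::zero_neq_one" where
  "diagonal J x = (if \<forall>i\<in>J. \<forall>j\<in>J. x i = x j then 1 else 0)"

lemma depends_onD: "depends_on S f \<Longrightarrow> (\<And>i. i \<in> S \<Longrightarrow> x i = y i) \<Longrightarrow> f x = f y"
  unfolding depends_on_def by blast

lemma splits_Compl:
  fixes u :: "('i \<Rightarrow> 'b) \<Rightarrow> 'a::comm_semiring_0"
  assumes "splits S u"
  shows "splits (- S) u"
proof -
  obtain f g where "u = (\<lambda>x. f x * g x)" "depends_on S f" "depends_on (- S) g"
    using assms unfolding splits_def by blast
  then show ?thesis unfolding splits_def
    by (intro exI[of _ g] exI[of _ f]) (auto simp: mult.commute)
qed

text \<open>Freezing the coordinates outside \<open>J\<close> at \<open>y\<close> turns a term into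
  a family of terms on \<open>J\<close>, one for each value of the other coordinates.\<close>

lemma splits_override_on:
  assumes "splits S u"
  shows "splits S (\<lambda>x. u (override_on y x J))"
proof -
  obtain f g where "u = (\<lambda>x. f x * g x)" "depends_on S f" "depends_on (- S) g"
    using assms unfolding splits_def by blast
  then show ?thesis unfolding splits_def
    by (intro exI[of _ "\<lambda>x. f (override_on y x J)"] exI[of _ "\<lambda>x. g (override_on y x J)"])
      (auto simp: depends_on_def override_on_def)
qed

text \<open>The factor depending on \<open>- S\<close> does not see the coordinates in
  \<open>J\<close>, so it comes out of the sum.\<close>

lemma splits_contract_subset:
  fixes u :: "('i \<Rightarrow> 'b) \<Rightarrow> 'a::comm_semiring_0"
  assumes "splits S u" "J \<subseteq> S"
  shows "splits S (\<lambda>y. \<Sum>t\<in>X. h t * u (override_on y (p t) J))"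
proof -
  obtain f g where u: "u = (\<lambda>x. f x * g x)" and f: "depends_on S f" and g: "depends_on (- S) g"
    using assms unfolding splits_def by blast
  have "g (override_on y (p t) J) = g y" for y t
    by (rule depends_onD[OF g]) (use assms(2) in \<open>auto simp: override_on_def\<close>)
  then have "(\<lambda>y. \<Sum>t\<in>X. h t * u (override_on y (p t) J))
      = (\<lambda>y. (\<Sum>t\<in>X. h t * f (override_on y (p t) J)) * g y)"
    by (simp add: u sum_distrib_right mult.assoc)
  moreover have "depends_on S (\<lambda>y. \<Sum>t\<in>X. h t * f (override_on y (p t) J))"
    unfolding depends_on_def
    by (intro allI impI sum.cong arg_cong2[of _ _ _ _ "(*)"] refl depends_onD[OF f])
      (auto simp: override_on_def)
  ultimately show ?thesis using g unfolding splits_def by (intro exI conjI)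
qed

text \<open>An uncut \<open>J\<close> lies in \<open>S\<close> or in its complement. Hence
  contracting one block preserves the product form of every term that does not cut it.\<close>

lemma splits_contract:
  fixes u :: "('i \<Rightarrow> 'b) \<Rightarrow> 'a::comm_semiring_0"
  assumes "splits S u" "\<not> cuts S J"
  shows "splits S (\<lambda>y. \<Sum>t\<in>X. h t * u (override_on y (p t) J))"
proof (cases "J \<subseteq> S")
  case True
  with assms(1) show ?thesis by (rule splits_contract_subset)
next
  case False
  then have "J \<subseteq> - S" using assms(2) by (auto simp: cuts_def)
  from splits_Compl[OF splits_contract_subset[OF splits_Compl[OF assms(1)] this]]
  show ?thesis by simp
qed

section \<open>Iterated sums over product sets\<close>

lemma sum_PiE_insert:
  fixes F :: "('i \<Rightarrow> 'b) \<Rightarrow> 'a::comm_monoid_add"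
  assumes "j \<notin> J"
  shows "(\<Sum>x\<in>PiE (insert j J) (\<lambda>_. A). F x) = (\<Sum>x\<in>PiE J (\<lambda>_. A). \<Sum>a\<in>A. F (x(j := a)))"
proof -
  have "(\<Sum>x\<in>PiE (insert j J) (\<lambda>_. A). F x) = (\<Sum>(x, a)\<in>PiE J (\<lambda>_. A) \<times> A. F (x(j := a)))"
    by (rule sum.reindex_bij_witness[of _ "\<lambda>(x, a). x(j := a)" "\<lambda>x. (restrict x J, x j)"])
      (use assms in \<open>auto simp: fun_eq_iff PiE_iff extensional_def restrict_def intro!: arg_cong[of _ _ F]\<close>)
  then show ?thesis by (simp add: sum.cartesian_product)
qed

lemma restrict_override_on:
  assumes "J \<inter> K = {}" "y \<in> extensional K" "x \<in> extensional J"
  shows "restrict (override_on y x J) K = y" "restrict (override_on y x J) J = x"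
proof -
  show "restrict (override_on y x J) J = x"
    using assms(3) by (intro ext) (simp add: extensional_def restrict_def)
  show "restrict (override_on y x J) K = y"
  proof
    fix i
    show "restrict (override_on y x J) K i = y i"
      using assms(1,2) by (cases "i \<in> K") (auto simp: extensional_def override_on_def)
  qed
qed

lemma sum_PiE_Un:
  fixes F :: "('i \<Rightarrow> 'b) \<Rightarrow> 'a::comm_monoid_add"
  assumes "J \<inter> K = {}"
  shows "(\<Sum>x\<in>PiE (J \<union> K) R. F x) = (\<Sum>y\<in>PiE K R. \<Sum>x\<in>PiE J R. F (override_on y x J))"
proof -
  have merge: "override_on (restrict x K) (restrict x J) J = x" if "x \<in> PiE (J \<union> K) R" for x
  proof
    fix i
    show "override_on (restrict x K) (restrict x J) J i = x i"
      using PiE_arb[OF that, of i] by (cases "i \<in> J"; cases "i \<in> K") auto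
  qed
  have "(\<Sum>x\<in>PiE (J \<union> K) R. F x) = (\<Sum>(y, x)\<in>PiE K R \<times> PiE J R. F (override_on y x J))"
  proof (rule sum.reindex_bij_witness[of _ "\<lambda>(y, x). override_on y x J" "\<lambda>x. (restrict x K, restrict x J)"])
    fix x assume x: "x \<in> PiE (J \<union> K) R"
    show "(restrict x K, restrict x J) \<in> PiE K R \<times> PiE J R" using x by auto
  next
    fix p assume p: "p \<in> PiE K R \<times> PiE J R"
    obtain y x where yx: "p = (y, x)" "y \<in> PiE K R" "x \<in> PiE J R" using p by blast
    then show "(restrict ((\<lambda>(y, x). override_on y x J) p) K,
        restrict ((\<lambda>(y, x). override_on y x J) p) J) = p"
      using restrict_override_on[OF assms, of y x] by (simp add: PiE_def)
    show "(\<lambda>(y, x). override_on y x J) p \<in> PiE (J \<union> K) R"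
      using yx assms by (auto simp: PiE_iff extensional_def override_on_def)
  qed (simp_all add: merge)
  then show ?thesis by (simp add: sum.cartesian_product)
qed

section \<open>The one-block case: contracting a diagonal tensor\<close>

text \<open>Here \<open>S\<close> separates \<open>j\<close> from all of \<open>J\<close>, so the
  term is a function of the value at \<open>j\<close> times a function independent of it. One linear
  equation on \<open>h\<close> therefore kills the contraction for every \<open>x\<close> at
  once.\<close>

lemma splits_single_coordinate:
  fixes u :: "('i \<Rightarrow> 'b) \<Rightarrow> 'a::comm_semiring_0"
  assumes "splits S u" "cuts S (insert j J)" "\<not> cuts S J" "j \<notin> J"
  shows "\<exists>w. \<forall>h. (\<Sum>a\<in>A. h a * w a) = 0 \<longrightarrow>
           (\<forall>x\<in>extensional J. (\<Sum>a\<in>A. h a * u (x(j := a))) = 0)"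
proof -
  have *: "\<exists>w. \<forall>h. (\<Sum>a\<in>A. h a * w a) = 0 \<longrightarrow>
           (\<forall>x\<in>extensional J. (\<Sum>a\<in>A. h a * u (x(j := a))) = 0)"
    if sp: "splits S u" and j: "j \<in> S" and J: "S \<inter> J = {}" for S
  proof -
    obtain f g where u: "u = (\<lambda>x. f x * g x)" and f: "depends_on S f" and g: "depends_on (- S) g"
      using sp unfolding splits_def by blast
    \<comment> \<open>Points extensional on \<open>J\<close> are \<open>undefined\<close> off
      \<open>J\<close>, and \<open>S\<close> misses \<open>J\<close>, so among the coordinates in
      \<open>S\<close> only the one at \<open>j\<close> varies.\<close>
    define w where "w a = f ((\<lambda>_. undefined)(j := a))" for a
    have "f (x(j := a)) = w a" if "x \<in> extensional J" for x a
      unfolding w_def by (rule depends_onD[OF f]) (use that J in \<open>auto simp: extensional_def\<close>)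
    moreover have "g (x(j := a)) = g x" for x a
      by (rule depends_onD[OF g]) (use j in auto)
    ultimately have "(\<Sum>a\<in>A. h a * u (x(j := a))) = (\<Sum>a\<in>A. h a * w a) * g x"
      if "x \<in> extensional J" for x h
      using that by (simp add: u sum_distrib_right mult.assoc)
    then show ?thesis by (intro exI[of _ w]) auto
  qed
  show ?thesis
  proof (cases "j \<in> S")
    case True
    then have "S \<inter> J = {}" using assms by (auto simp: cuts_def)
    with True assms(1) show ?thesis by (intro *)
  next
    case False
    then have "- S \<inter> J = {}" using assms by (auto simp: cuts_def)
    with False splits_Compl[OF assms(1)] show ?thesis by (intro *[of "- S"]) auto
  qed
qed

text \<open>The weights \<open>c\<close> absorb the contracting vector in the induction on \<open>J\<close>.\<close>

lemma diagonal_functional: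
  fixes u :: "'k \<Rightarrow> ('i \<Rightarrow> 'b) \<Rightarrow> 'a::field" and c :: "'b \<Rightarrow> 'a"
  assumes "finite J" "J \<noteq> {}" "finite A" "finite I" "card I < card A"
    and "\<And>a. a \<in> A \<Longrightarrow> c a \<noteq> 0"
    and "\<And>i. i \<in> I \<Longrightarrow> cuts (S i) J \<and> splits (S i) (u i)"
  shows "\<exists>H. (\<forall>i\<in>I. (\<Sum>x\<in>PiE J (\<lambda>_. A). H x * u i x) = 0) \<and>
             (\<Sum>a\<in>A. c a * H (restrict (\<lambda>_. a) J)) \<noteq> 0"
  using assms
proof (induction J arbitrary: A I u c rule: finite_ne_induct)
  case (singleton j)
  \<comment> \<open>A one-element block cannot be cut, so only the nonvanishing has to be
    arranged.\<close>
  have "I = {}" using singleton.prems(5) by (auto simp: cuts_def)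
  obtain a0 where a0: "a0 \<in> A" using singleton.prems by fastforce
  define H :: "('i \<Rightarrow> 'b) \<Rightarrow> 'a" where "H x = (if x j = a0 then 1 else 0)" for x
  have "(\<Sum>a\<in>A. c a * H (restrict (\<lambda>_. a) {j})) = c a0"
    using a0 singleton.prems(1) by (simp add: H_def if_distrib sum.delta cong: if_cong)
  then have "(\<Sum>a\<in>A. c a * H (restrict (\<lambda>_. a) {j})) \<noteq> 0"
    using singleton.prems(4) a0 by simp
  with \<open>I = {}\<close> show ?case by blast
next
  case (insert j J)
  note fin = insert.prems(1,2)
  \<comment> \<open>Terms in \<open>I0\<close> separate \<open>j\<close> from the rest of the block
    and cost one equation each on the contracting vector; those in \<open>I1\<close> still cut
    \<open>J\<close> after the contraction.\<close>
  define I0 where "I0 = {i \<in> I. \<not> cuts (S i) J}"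
  define I1 where "I1 = {i \<in> I. cuts (S i) J}"
  have "card (I0 \<union> I1) = card I0 + card I1"
    using fin by (intro card_Un_disjoint) (auto simp: I0_def I1_def)
  moreover have "I0 \<union> I1 = I" by (auto simp: I0_def I1_def)
  ultimately have card_I: "card I = card I0 + card I1" by simp
  have "\<forall>i\<in>I0. \<exists>w. \<forall>h. (\<Sum>a\<in>A. h a * w a) = 0 \<longrightarrow>
           (\<forall>x\<in>extensional J. (\<Sum>a\<in>A. h a * u i (x(j := a))) = 0)"
    using insert.prems(5) insert.hyps by (auto simp: I0_def intro!: splits_single_coordinate)
  then obtain w where w: "\<And>i h x. i \<in> I0 \<Longrightarrow> (\<Sum>a\<in>A. h a * w i a) = 0 \<Longrightarrow>
           x \<in> extensional J \<Longrightarrow> (\<Sum>a\<in>A. h a * u i (x(j := a))) = 0"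
    by metis
  have "finite I0" using fin by (simp add: I0_def)
  then obtain h where h: "card A \<le> card {a \<in> A. h a \<noteq> 0} + card I0"
    "\<forall>i\<in>I0. (\<Sum>a\<in>A. h a * w i a) = 0"
    using linear_system_large_support[OF _ fin(1), of I0 w] by blast
  \<comment> \<open>Contracting \<open>j\<close> by \<open>h\<close> leaves a diagonal on
    \<open>J\<close> with weights \<open>c a * h a\<close>, nonzero on \<open>A'\<close>. At most
    \<open>card I0\<close> values are lost, so \<open>card I1 < card A'\<close>.\<close>
  define A' where "A' = {a \<in> A. h a \<noteq> 0}"
  define u' where "u' i x = (\<Sum>a\<in>A. h a * u i (x(j := a)))" for i x
  have "card I1 < card A'" using h(1) card_I insert.prems(3) by (simp add: A'_def)
  moreover have "cuts (S i) J \<and> splits (S i) (u' i)" if "i \<in> I1" for i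
  proof
    show "cuts (S i) J" using that by (simp add: I1_def)
    have "splits (S i) (\<lambda>y. \<Sum>a\<in>A. h a * u i (override_on y (\<lambda>_. a) {j}))"
      using insert.prems(5) that by (intro splits_contract) (auto simp: I1_def cuts_def)
    then show "splits (S i) (u' i)"
      by (simp add: u'_def[abs_def] override_on_insert)
  qed
  moreover have "finite A'" "finite I1" "\<And>a. a \<in> A' \<Longrightarrow> c a * h a \<noteq> 0"
    using insert.prems(4) fin by (simp_all add: A'_def I1_def)
  ultimately have "\<exists>H'. (\<forall>i\<in>I1. (\<Sum>x\<in>PiE J (\<lambda>_. A'). H' x * u' i x) = 0) \<and>
      (\<Sum>a\<in>A'. (c a * h a) * H' (restrict (\<lambda>_. a) J)) \<noteq> 0"
    by (intro insert.IH)
  then obtain H' where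
    H': "\<And>i. i \<in> I1 \<Longrightarrow> (\<Sum>x\<in>PiE J (\<lambda>_. A'). H' x * u' i x) = 0"
      "(\<Sum>a\<in>A'. (c a * h a) * H' (restrict (\<lambda>_. a) J)) \<noteq> 0"
    by blast
  \<comment> \<open>\<open>H'\<close> is controlled only on the box over \<open>A'\<close>, hence
    the extension by zero to the box over \<open>A\<close>.\<close>
  define G where "G x = (if x \<in> PiE J (\<lambda>_. A') then H' x else 0)" for x
  define H where "H x = h (x j) * G (restrict x J)" for x
  have H_upd: "H (x(j := a)) = h a * G x" if "x \<in> PiE J (\<lambda>_. A)" for x a
  proof -
    have "restrict (x(j := a)) J = x"
      using that insert.hyps by (auto simp: fun_eq_iff PiE_iff extensional_def)
    then show ?thesis by (simp add: H_def)
  qed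
  have sum_H: "(\<Sum>x\<in>PiE (insert j J) (\<lambda>_. A). H x * u i x) = (\<Sum>x\<in>PiE J (\<lambda>_. A). G x * u' i x)" for i
    using insert.hyps
    by (auto simp: sum_PiE_insert H_upd u'_def sum_distrib_left mult_ac intro!: sum.cong)
  have "(\<Sum>x\<in>PiE (insert j J) (\<lambda>_. A). H x * u i x) = 0" if "i \<in> I" for i
  proof (cases "i \<in> I0")
    case True
    then have "u' i x = 0" if "x \<in> PiE J (\<lambda>_. A)" for x
      using w[OF True] h(2) that by (auto simp: u'_def PiE_iff)
    then show ?thesis by (simp add: sum_H)
  next
    case False
    have "(\<Sum>x\<in>PiE J (\<lambda>_. A). G x * u' i x) = (\<Sum>x\<in>PiE J (\<lambda>_. A'). H' x * u' i x)"
      using fin insert.hyps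
      by (intro sum.mono_neutral_cong_right finite_PiE PiE_mono) (auto simp: G_def A'_def)
    with False that H'(1) show ?thesis by (simp add: sum_H I0_def I1_def)
  qed
  moreover have "(\<Sum>a\<in>A. c a * H (restrict (\<lambda>_. a) (insert j J)))
      = (\<Sum>a\<in>A'. (c a * h a) * H' (restrict (\<lambda>_. a) J))"
  proof (rule sum.mono_neutral_cong_right)
    show "c a * H (restrict (\<lambda>_. a) (insert j J)) = (c a * h a) * H' (restrict (\<lambda>_. a) J)"
      if "a \<in> A'" for a
    proof -
      have "restrict (restrict (\<lambda>_. a) (insert j J)) J = restrict (\<lambda>_. a) J" by auto
      then show ?thesis using that by (simp add: H_def G_def)
    qed
  qed (use fin in \<open>auto simp: A'_def H_def\<close>)
  ultimately show ?case using H'(2) by metis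
qed

text \<open>Only constant points survive, and they correspond to \<open>A\<close> because
  \<open>J\<close> is non-empty. With all weights \<open>c\<close> equal to 1, this makes the second
  conclusion of \<open>diagonal_functional\<close> a pairing with the diagonal tensor.\<close>

lemma sum_diagonal:
  fixes H :: "('i \<Rightarrow> 'b) \<Rightarrow> 'a::comm_semiring_1"
  assumes "finite J" "J \<noteq> {}" "finite A"
  shows "(\<Sum>x\<in>PiE J (\<lambda>_. A). H x * diagonal J x) = (\<Sum>a\<in>A. H (restrict (\<lambda>_. a) J))"
proof -
  obtain j where j: "j \<in> J" using assms by blast
  have "(\<Sum>x\<in>PiE J (\<lambda>_. A). H x * diagonal J x)
      = (\<Sum>x\<in>(\<lambda>a. restrict (\<lambda>_. a) J) ` A. H x)"
  proof (rule sum.mono_neutral_cong_right)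
    show "\<forall>x\<in>PiE J (\<lambda>_. A) - (\<lambda>a. restrict (\<lambda>_. a) J) ` A. H x * diagonal J x = 0"
    proof
      fix x assume x: "x \<in> PiE J (\<lambda>_. A) - (\<lambda>a. restrict (\<lambda>_. a) J) ` A"
      have "\<not> (\<forall>i\<in>J. \<forall>j\<in>J. x i = x j)"
      proof
        assume const: "\<forall>i\<in>J. \<forall>j\<in>J. x i = x j"
        have "x = restrict (\<lambda>_. x j) J"
        proof
          fix i
          have "x i = x j" if "i \<in> J" using const that j by blast
          moreover have "x i = undefined" if "i \<notin> J" using x that by (meson DiffD1 PiE_arb)
          ultimately show "x i = restrict (\<lambda>_. x j) J i" by (simp add: restrict_def)
        qed
        moreover have "x j \<in> A" using x j by blast
        ultimately show False using x by blast
      qed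
      then show "H x * diagonal J x = 0" unfolding diagonal_def by (simp only: if_False mult_zero_right)
    qed
  qed (use assms in \<open>auto intro!: finite_PiE simp: diagonal_def\<close>)
  also have "\<dots> = (\<Sum>a\<in>A. H (restrict (\<lambda>_. a) J))"
  proof -
    have "inj_on (\<lambda>a. restrict (\<lambda>_. a) J) A"
      using j by (intro inj_onI) (metis restrict_apply')
    then show ?thesis by (simp add: sum.reindex)
  qed
  finally show ?thesis .
qed

section \<open>Several blocks with ranges of different lengths\<close>

lemma diagonal_override_on_same: "diagonal J (override_on y x J) = diagonal J x"
  by (simp add: diagonal_def)

lemma diagonal_override_on_disjoint:
  assumes "J \<inter> K = {}"
  shows "diagonal K (override_on y x J) = diagonal K y"
proof -
  have "override_on y x J i = y i" if "i \<in> K" for i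
    using that assms by (auto simp: override_on_def)
  then show ?thesis by (simp add: diagonal_def)
qed

lemma power_increasing_nat:
  fixes i j k :: nat
  assumes "1 \<le> i" "i \<le> j"
  shows "k ^ i \<le> k ^ j"
  using assms by (cases "k = 0") (auto simp: power_0_left power_increasing)

text \<open>
  The ranges \<open>r\<close> depend only on the sets \<open>S i\<close>, not on the terms \<open>u i\<close>: the range for one block has to
  be chosen before that block is contracted, and contraction changes the terms on the other blocks.
\<close>

lemma blocks_functional:
  fixes S :: "'k \<Rightarrow> 'i set"
  assumes "finite B" "disjoint B" "\<forall>J\<in>B. finite J \<and> J \<noteq> {} \<and> card J \<le> d"
    and "finite I" "\<forall>i\<in>I. \<exists>J\<in>B. cuts (S i) J"
  shows "\<exists>r. (\<forall>j. r j \<le> card I ^ ((d + 1) ^ card B) + 1) \<and>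
     card (PiE (\<Union>B) (\<lambda>j. {1..r j})) \<le> (card I + 1) ^ ((d + 1) ^ card B - 1) \<and>
     (\<forall>u :: 'k \<Rightarrow> ('i \<Rightarrow> nat) \<Rightarrow> 'a::field. (\<forall>i\<in>I. splits (S i) (u i)) \<longrightarrow>
       (\<exists>H. (\<forall>i\<in>I. (\<Sum>x\<in>PiE (\<Union>B) (\<lambda>j. {1..r j}). H x * u i x) = 0) \<and>
            (\<Sum>x\<in>PiE (\<Union>B) (\<lambda>j. {1..r j}). H x * (\<Prod>J\<in>B. diagonal J x)) \<noteq> 0))"
  using assms
proof (induction B arbitrary: I rule: finite_induct)
  case empty
  then have "I = {}" by auto
  then show ?case by (intro exI[of _ "\<lambda>_. 1"]) (auto intro!: exI[of _ "\<lambda>_. 1"])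
next
  case (insert J B)
  \<comment> \<open>\<open>I0\<close> is annihilated on \<open>J\<close>, for every point of the
    other blocks; \<open>I1\<close> goes to the induction hypothesis after \<open>J\<close> is
    contracted. The ranges of the other blocks are fixed first.\<close>
  define I0 where "I0 = {i \<in> I. cuts (S i) J}"
  define I1 where "I1 = {i \<in> I. \<not> cuts (S i) J}"
  define k where "k = card I"
  define e where "e = (d + 1) ^ card B"
  have fin_I: "finite I0" "finite I1" "I = I0 \<union> I1" "I0 \<inter> I1 = {}"
    using insert.prems(3) by (auto simp: I0_def I1_def)
  then have k: "k = card I0 + card I1" by (simp add: k_def card_Un_disjoint)
  have e: "e \<ge> 1" "(d + 1) ^ card (insert J B) = (d + 1) * e"
    using insert.hyps by (simp_all add: e_def)
  have J: "finite J" "J \<noteq> {}" "card J \<le> d" using insert.prems(2) by auto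
  have disj: "J \<inter> K = {}" if "K \<in> B" for K
    using insert.prems(1) insert.hyps that by (auto simp: disjoint_def)
  then have disjU: "J \<inter> \<Union>B = {}" by blast
  have disjB: "disjoint B" using insert.prems(1) by (simp add: disjoint_def)
  have blocks: "\<forall>J\<in>B. finite J \<and> J \<noteq> {} \<and> card J \<le> d"
    using insert.prems(2) by blast
  have cut: "\<forall>i\<in>I1. \<exists>J\<in>B. cuts (S i) J"
    using insert.prems(4) by (auto simp: I1_def)
  from insert.IH[of I1, folded e_def, OF disjB blocks fin_I(2) cut]
  obtain r where
    r: "\<forall>j. r j \<le> card I1 ^ e + 1" and
    card_X: "card (PiE (\<Union>B) (\<lambda>j. {1..r j})) \<le> (card I1 + 1) ^ (e - 1)" and
    IH: "\<forall>u :: 'k \<Rightarrow> ('i \<Rightarrow> nat) \<Rightarrow> 'a. (\<forall>i\<in>I1. splits (S i) (u i)) \<longrightarrow>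
       (\<exists>H. (\<forall>i\<in>I1. (\<Sum>x\<in>PiE (\<Union>B) (\<lambda>j. {1..r j}). H x * u i x) = 0) \<and>
            (\<Sum>x\<in>PiE (\<Union>B) (\<lambda>j. {1..r j}). H x * (\<Prod>J\<in>B. diagonal J x)) \<noteq> 0)"
    by (elim exE conjE) (rule that)
  define X where "X = PiE (\<Union>B) (\<lambda>j. {1..r j})"
  have fin_X: "finite X"
    unfolding X_def using insert.hyps(1) insert.prems(2) by (intro finite_PiE) auto
  have card_X: "card X \<le> (card I1 + 1) ^ (e - 1)" using card_X by (simp add: X_def)
  \<comment> \<open>The one-block case receives one term for each \<open>i\<close> in
    \<open>I0\<close> and each point of \<open>X\<close>, so \<open>m + 1\<close> values per
    coordinate of \<open>J\<close> suffice.\<close>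
  define m where "m = card I0 * card X"
  define A where "A = {1..m + 1}"
  define r' where "r' j = (if j \<in> J then m + 1 else r j)" for j
  define Z where "Z = PiE (\<Union>(insert J B)) (\<lambda>j. {1..r' j})"
  have "PiE J (\<lambda>j. {1..r' j}) = PiE J (\<lambda>_. A)"
    by (rule PiE_cong) (simp add: A_def r'_def)
  moreover have "PiE (\<Union>B) (\<lambda>j. {1..r' j}) = X"
    unfolding X_def using disjU by (intro PiE_cong) (auto simp: r'_def)
  ultimately have sum_Z: "(\<Sum>x\<in>Z. F x) = (\<Sum>y\<in>X. \<Sum>x\<in>PiE J (\<lambda>_. A). F (override_on y x J))"
    for F :: "('i \<Rightarrow> nat) \<Rightarrow> 'b::comm_monoid_add"
    using sum_PiE_Un[OF disjU, of F "\<lambda>j. {1..r' j}"] by (simp add: Z_def)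
  \<comment> \<open>If \<open>I0\<close> is non-empty, \<open>card I1 + 1\<close> is at most
    \<open>k\<close>, which gives a power of \<open>k\<close> rather than of \<open>k + 1\<close>;
    otherwise \<open>m = 0\<close>.\<close>
  have m_le: "m \<le> k ^ e"
  proof (cases "card I0 = 0")
    case False
    then have "card I1 + 1 \<le> k" using k by simp
    then have "m \<le> k * k ^ (e - 1)"
      unfolding m_def using k card_X
      by (intro mult_mono order.trans[OF card_X] power_mono) auto
    also have "\<dots> = k ^ e" using e by (simp add: power_eq_if)
    finally show ?thesis .
  qed (simp add: m_def)
  have r'_le: "r' j \<le> k ^ ((d + 1) * e) + 1" for j
  proof -
    have *: "k ^ e \<le> k ^ ((d + 1) * e)"
      using e by (intro power_increasing_nat) auto
    have "card I1 ^ e \<le> k ^ e" using k by (intro power_mono) auto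
    with spec[OF r, of j] m_le * show ?thesis by (auto simp: r'_def)
  qed
  \<comment> \<open>The exponents add up as \<open>(e - 1) + d * e = (d + 1) * e - 1\<close>. The
    \<open>- 1\<close> leaves room for the factor \<open>card I0\<close> in the next
    \<open>m\<close>.\<close>
  have card_Z: "card Z \<le> (k + 1) ^ ((d + 1) * e - 1)"
  proof -
    have "card Z = card X * (m + 1) ^ card J"
      using sum_Z[of "\<lambda>_. 1::nat"] J(1) by (simp add: card_PiE A_def)
    also have "\<dots> \<le> (k + 1) ^ (e - 1) * ((k + 1) ^ e) ^ d"
    proof (intro mult_mono)
      show "card X \<le> (k + 1) ^ (e - 1)"
        using card_X k by (elim order.trans) (simp add: power_mono)
      have "m + 1 \<le> (k + 1) ^ e"
      proof -
        have "k ^ e + 1 \<le> (k + 1) ^ e"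
          using power_strict_mono[of k "k + 1" e] e by simp
        with m_le show ?thesis by simp
      qed
      then have "(m + 1) ^ card J \<le> ((k + 1) ^ e) ^ card J" by (intro power_mono) auto
      also have "\<dots> \<le> ((k + 1) ^ e) ^ d" using J(3) by (intro power_increasing) auto
      finally show "(m + 1) ^ card J \<le> ((k + 1) ^ e) ^ d" .
    qed auto
    also have "\<dots> = (k + 1) ^ ((d + 1) * e - 1)"
      using e(1) by (simp add: power_mult[symmetric] power_add[symmetric] algebra_simps)
    finally show ?thesis .
  qed
  have "\<exists>H. (\<forall>i\<in>I. (\<Sum>x\<in>Z. H x * u i x) = 0) \<and>
            (\<Sum>x\<in>Z. H x * (\<Prod>K\<in>insert J B. diagonal K x)) \<noteq> 0"
    if u: "\<forall>i\<in>I. splits (S i) (u i)" for u :: "'k \<Rightarrow> ('i \<Rightarrow> nat) \<Rightarrow> 'a"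
  proof -
    \<comment> \<open>A single \<open>G\<close> is obtained for all slices: each term of
      \<open>I0\<close> is frozen at each \<open>y\<close> in \<open>X\<close>.\<close>
    have "card (I0 \<times> X) < card A" by (simp add: m_def A_def card_cartesian_product)
    moreover have "cuts (case p of (i, y) \<Rightarrow> S i) J \<and>
        splits (case p of (i, y) \<Rightarrow> S i) (case p of (i, y) \<Rightarrow> \<lambda>x. u i (override_on y x J))"
      if "p \<in> I0 \<times> X" for p
      using that u by (auto simp: I0_def intro: splits_override_on)
    moreover have "finite A" "finite (I0 \<times> X)" using fin_I fin_X by (auto simp: A_def)
    ultimately have "\<exists>G. (\<forall>p\<in>I0 \<times> X. (\<Sum>x\<in>PiE J (\<lambda>_. A).
          G x * (case p of (i, y) \<Rightarrow> \<lambda>x. u i (override_on y x J)) x) = 0) \<and>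
        (\<Sum>a\<in>A. 1 * G (restrict (\<lambda>_. a) J)) \<noteq> 0"
      using J by (intro diagonal_functional[where S = "\<lambda>(i, y). S i"]) simp_all
    then obtain G where
      G: "\<And>i y. i \<in> I0 \<Longrightarrow> y \<in> X \<Longrightarrow>
        (\<Sum>x\<in>PiE J (\<lambda>_. A). G x * u i (override_on y x J)) = 0" and
      G0: "(\<Sum>a\<in>A. G (restrict (\<lambda>_. a) J)) \<noteq> 0"
      by auto
    define u' where "u' i y = (\<Sum>x\<in>PiE J (\<lambda>_. A). G x * u i (override_on y x J))" for i y
    have "splits (S i) (u' i)" if "i \<in> I1" for i
      unfolding u'_def[abs_def]
      using that u by (intro splits_contract[where p = "\<lambda>x. x"]) (auto simp: I1_def)
    then obtain H' where
      H': "\<forall>i\<in>I1. (\<Sum>y\<in>X. H' y * u' i y) = 0"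
        "(\<Sum>y\<in>X. H' y * (\<Prod>K\<in>B. diagonal K y)) \<noteq> 0"
      using IH[folded X_def, rule_format, of u'] by blast
    \<comment> \<open>\<open>H\<close> is a product functional: \<open>G\<close> annihilates the
      terms of \<open>I0\<close>, \<open>H'\<close> the contracted terms of \<open>I1\<close>, and
      the pairing with the product of diagonals factors.\<close>
    define H where "H x = H' (restrict x (\<Union>B)) * G (restrict x J)" for x
    have H: "H (override_on y x J) = H' y * G x" if "y \<in> X" "x \<in> PiE J (\<lambda>_. A)" for x y
    proof -
      have "y \<in> extensional (\<Union>B)" "x \<in> extensional J"
        using that by (simp_all add: X_def PiE_def)
      from restrict_override_on[OF disjU this] show ?thesis by (simp add: H_def)
    qed
    have sum_u: "(\<Sum>x\<in>Z. H x * v x)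
        = (\<Sum>y\<in>X. H' y * (\<Sum>x\<in>PiE J (\<lambda>_. A). G x * v (override_on y x J)))" for v
      unfolding sum_Z by (auto simp: H sum_distrib_left mult_ac intro!: sum.cong)
    have "(\<Sum>x\<in>Z. H x * u i x) = 0" if "i \<in> I" for i
    proof (cases "i \<in> I0")
      case True
      with G show ?thesis unfolding sum_u by auto
    next
      case False
      with that H'(1) fin_I(3) show ?thesis unfolding sum_u u'_def by auto
    qed
    moreover have "(\<Sum>x\<in>Z. H x * (\<Prod>K\<in>insert J B. diagonal K x)) \<noteq> 0"
    proof -
      have "(\<Prod>K\<in>insert J B. diagonal K (override_on y x J) :: 'a)
          = diagonal J x * (\<Prod>K\<in>B. diagonal K y)" for x y :: "'i \<Rightarrow> nat"
      proof -
        have "(\<Prod>K\<in>B. diagonal K (override_on y x J) :: 'a) = (\<Prod>K\<in>B. diagonal K y)"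
          using disj by (intro prod.cong diagonal_override_on_disjoint) auto
        then show ?thesis
          using insert.hyps by (simp add: diagonal_override_on_same)
      qed
      then have "(\<Sum>x\<in>Z. H x * (\<Prod>K\<in>insert J B. diagonal K x))
        = (\<Sum>x\<in>PiE J (\<lambda>_. A). G x * diagonal J x) * (\<Sum>y\<in>X. H' y * (\<Prod>K\<in>B. diagonal K y))"
        unfolding sum_u by (simp add: sum_distrib_left sum_distrib_right mult_ac)
      with H'(2) G0 J show ?thesis by (simp add: sum_diagonal A_def)
    qed
    ultimately show ?thesis by blast
  qed
  with r'_le card_Z show ?case
    unfolding e(2) k_def[symmetric] Z_def by blast
qed

section \<open>Numerical estimates for the exponent\<close>

text \<open>Compares the exponent from the block argument with the reciprocal of the one in the
  theorem, through \<open>(2 ^ d) ^ d = 2 ^ (d * d)\<close>.\<close>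

lemma exponent_bound: "(d + 1) ^ d \<le> (3::nat) ^ (2 ^ (d + 1))"
proof -
  have sq: "d * d \<le> 2 ^ (d + 1)"
  proof (induction d rule: less_induct)
    case (less d)
    show ?case
    proof (cases "d < 3")
      case True
      then have "d = 0 \<or> d = 1 \<or> d = 2" by auto
      then show ?thesis by auto
    next
      case False
      define c where "c = d - 1"
      have c: "d = c + 1" "c \<ge> 2" using False by (simp_all add: c_def)
      show ?thesis
      \<comment> \<open>For \<open>c = 2\<close> the bound \<open>d * d \<le> 2 * (c * c)\<close>
        fails, as 9 exceeds 8, so \<open>d = 3\<close> is computed directly.\<close>
      proof (cases "c = 2")
        case False
        then have "3 * c \<le> c * c" using c by (intro mult_le_mono1) auto
        moreover have "d * d = c * c + 2 * c + 1" using c by (simp add: algebra_simps)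
        ultimately have "d * d \<le> 2 * (c * c)" using c by linarith
        also have "\<dots> \<le> 2 ^ (d + 1)" using less[of c] c by simp
        finally show ?thesis .
      qed (simp add: c)
    qed
  qed
  have "d + 1 \<le> 2 ^ d" by (induction d) auto
  then have "(d + 1) ^ d \<le> (2 ^ d) ^ d" by (intro power_mono) auto
  also have "\<dots> = 2 ^ (d * d)" by (simp add: power_mult)
  also have "\<dots> \<le> 2 ^ (2 ^ (d + 1))" using sq by (intro power_increasing) auto
  also have "\<dots> \<le> 3 ^ (2 ^ (d + 1))" by (intro power_mono) auto
  finally show ?thesis .
qed

lemma three_powr_minus_two_power: "3 powr (- (2 ^ m)) = 1 / real (3 ^ (2 ^ m))"
proof -
  have "3 powr (2 ^ m) = (3::real) powr real (2 ^ m)" by simp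
  also have "\<dots> = 3 ^ (2 ^ m)" by (rule powr_realpow) simp
  finally show ?thesis by (simp only: powr_minus_divide of_nat_power of_nat_numeral)
qed

lemma less_powr_inverse_power:
  fixes k n M :: nat
  assumes "real k < real n powr (1 / real M)" "M > 0"
  shows "k ^ M < n"
proof -
  have "real k ^ M < (real n powr (1 / real M)) ^ M"
    using assms by (intro power_strict_mono) auto
  also have "\<dots> = real n"
    using assms by (cases "n = 0") (simp_all add: powr_realpow[symmetric] powr_powr)
  finally show ?thesis using of_nat_less_imp_less by fastforce
qed

section \<open>From decompositions of tensors to split terms\<close>

text \<open>All blocks other than \<open>S\<close> are disjoint from \<open>S\<close>, so the
  product of their factors depends only on the complement.\<close>

lemma splits_prod_partition:
  fixes a :: "'i set \<Rightarrow> ('i \<Rightarrow> 'b) \<Rightarrow> 'a::field"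
  assumes "partition_on V P" "finite P" "S \<in> P"
  shows "splits S (\<lambda>x. \<Prod>K\<in>P. a K (restrict x K))"
proof -
  have eq: "(\<lambda>x. \<Prod>K\<in>P. a K (restrict x K))
      = (\<lambda>x. a S (restrict x S) * (\<Prod>K\<in>P - {S}. a K (restrict x K)))"
    using assms by (simp add: prod.remove)
  have "depends_on S (\<lambda>x. a S (restrict x S))"
    unfolding depends_on_def by (metis restrict_ext)
  moreover have "depends_on (- S) (\<lambda>x. \<Prod>K\<in>P - {S}. a K (restrict x K))"
    unfolding depends_on_def
  proof (intro allI impI prod.cong refl)
    fix x y :: "'i \<Rightarrow> 'b" and K assume xy: "\<forall>i\<in>- S. x i = y i" and K: "K \<in> P - {S}"
    then have "K \<inter> S = {}" using assms by (auto simp: partition_on_def disjoint_def)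
    then have "restrict x K = restrict y K" using xy by (intro restrict_ext) auto
    then show "a K (restrict x K) = a K (restrict y K)" by simp
  qed
  ultimately show ?thesis unfolding splits_def eq by (intro exI conjI) (rule refl)
qed

lemma R_rank_eq_1:
  fixes T :: "'a::field tensor"
  assumes "R_rank_le_one d ns R T" "x \<in> index_box d ns" "T x \<noteq> 0"
  shows "R_rank d ns R T = 1"
  unfolding R_rank_def
proof (rule Least_equality)
  show "R_decomposable d ns R T 1"
    using assms(1) unfolding R_decomposable_def by (intro exI[of _ "\<lambda>_. T"]) simp
  show "1 \<le> k" if "R_decomposable d ns R T k" for k
    using that assms(2,3) unfolding R_decomposable_def by (cases k) auto
qed

text \<open>For larger \<open>n\<close> the ranges from \<open>blocks_functional\<close> would fit
  into \<open>{1..n}\<close>, and its functional would vanish on the sum of the terms but not on the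
  tensor.\<close>

lemma diagonal_R_decomposable_lower_bound:
  fixes d n k :: nat and R :: "nat set set set"
  assumes part: "partition_on {1..d} P" and R: "\<And>Q. Q \<in> R \<Longrightarrow> partition_on {1..d} Q"
    and notfiner: "\<And>Q. Q \<in> R \<Longrightarrow> \<exists>J\<in>P. \<forall>K\<in>Q. \<not> J \<subseteq> K"
    and dec: "R_decomposable d (\<lambda>_. n) R (\<lambda>x. \<Prod>J\<in>P. diagonal J x :: 'a::field) k"
  shows "n \<le> k ^ ((d + 1) ^ d)"
proof (rule ccontr)
  assume "\<not> n \<le> k ^ ((d + 1) ^ d)"
  then have n: "k ^ ((d + 1) ^ d) + 1 \<le> n" by simp
  have UP: "\<Union>P = {1..d}" and disjP: "disjoint P" and neP: "{} \<notin> P"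
    using part by (auto simp: partition_on_def)
  have finP: "finite P" using part finite_elements by blast
  obtain u where u: "\<And>i. i < k \<Longrightarrow> R_rank_le_one d (\<lambda>_. n) R (u i)"
    and sum_u: "\<And>x. x \<in> index_box d (\<lambda>_. n) \<Longrightarrow>
      (\<Prod>J\<in>P. diagonal J x :: 'a) = (\<Sum>i<k. u i x)"
    using dec unfolding R_decomposable_def by blast
  \<comment> \<open>The product form of \<open>u i\<close> is known on the box only, while
    \<open>splits\<close> concerns all points; hence a function \<open>v\<close> agreeing with
    \<open>u i\<close> on the box.\<close>
  have "\<exists>S v. (\<exists>J\<in>P. cuts S J) \<and> splits S v \<and> (\<forall>x\<in>index_box d (\<lambda>_. n). u i x = v x)"
    if i: "i < k" for i
  proof -
    obtain Q a where Q: "Q \<in> R"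
      and a: "\<And>x. x \<in> index_box d (\<lambda>_. n) \<Longrightarrow> u i x = (\<Prod>K\<in>Q. a K (restrict x K))"
      using u[OF i] unfolding R_rank_le_one_def by blast
    note Qp = R[OF Q]
    have finQ: "finite Q" using Qp finite_elements by blast
    obtain J where J: "J \<in> P" "\<forall>K\<in>Q. \<not> J \<subseteq> K" using notfiner[OF Q] by blast
    \<comment> \<open>The block of \<open>Q\<close> through any point of \<open>J\<close> meets
      \<open>J\<close> without containing it, so it cuts \<open>J\<close>.\<close>
    obtain j where j: "j \<in> J" using J(1) neP by (metis all_not_in_conv)
    then have "j \<in> {1..d}" using J(1) UP by blast
    then obtain K where K: "K \<in> Q" "j \<in> K" using partition_onD1[OF Qp] by blast
    have "cuts K J" using J(2) K j by (auto simp: cuts_def)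
    then show ?thesis using splits_prod_partition[OF Qp finQ K(1), of a] a J(1) by blast
  qed
  then obtain S v where cut: "\<And>i. i < k \<Longrightarrow> \<exists>J\<in>P. cuts (S i) J"
    and spl: "\<And>i. i < k \<Longrightarrow> splits (S i) (v i)"
    and uv: "\<And>i x. i < k \<Longrightarrow> x \<in> index_box d (\<lambda>_. n) \<Longrightarrow> u i x = v i x"
    by metis
  have blocks: "finite J \<and> J \<noteq> {} \<and> card J \<le> d" if "J \<in> P" for J
  proof -
    have "J \<subseteq> {1..d}" using that UP by blast
    then show ?thesis using card_mono[of "{1..d}" J] finite_subset that neP by auto
  qed
  have "card P = (\<Sum>J\<in>P. 1)" by simp
  also have "\<dots> \<le> (\<Sum>J\<in>P. card J)"
    using blocks by (intro sum_mono) (auto simp: Suc_le_eq card_gt_0_iff)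
  also have "\<dots> = d"
    using card_Union_disjoint[of P] disjP blocks UP by (auto simp: disjoint_def pairwise_def disjnt_def)
  finally have cardP: "card P \<le> d" .
  have "\<forall>J\<in>P. finite J \<and> J \<noteq> {} \<and> card J \<le> d" "\<forall>i\<in>{..<k}. \<exists>J\<in>P. cuts (S i) J"
    using blocks cut by auto
  from blocks_functional[OF finP disjP this(1) finite_lessThan this(2), where ?'a = 'a,
      unfolded UP card_lessThan]
  obtain r where r: "\<forall>j. r j \<le> k ^ ((d + 1) ^ card P) + 1"
    and ex_H: "\<forall>u :: nat \<Rightarrow> (nat \<Rightarrow> nat) \<Rightarrow> 'a. (\<forall>i\<in>{..<k}. splits (S i) (u i)) \<longrightarrow>
      (\<exists>H. (\<forall>i\<in>{..<k}. (\<Sum>x\<in>PiE {1..d} (\<lambda>j. {1..r j}). H x * u i x) = 0) \<and>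
          (\<Sum>x\<in>PiE {1..d} (\<lambda>j. {1..r j}). H x * (\<Prod>J\<in>P. diagonal J x)) \<noteq> 0)"
    by (elim exE conjE) (rule that)
  have "\<forall>i\<in>{..<k}. splits (S i) (v i)" using spl by simp
  from mp[OF spec[OF ex_H] this] obtain H
    where H: "\<forall>i\<in>{..<k}. (\<Sum>x\<in>PiE {1..d} (\<lambda>j. {1..r j}). H x * v i x) = 0"
    and H0: "(\<Sum>x\<in>PiE {1..d} (\<lambda>j. {1..r j}). H x * (\<Prod>J\<in>P. diagonal J x)) \<noteq> 0"
    by (elim exE conjE) (rule that)
  have "k ^ ((d + 1) ^ card P) \<le> k ^ ((d + 1) ^ d)"
    using cardP by (intro power_increasing_nat power_increasing) auto
  then have "r j \<le> n" for j using spec[OF r, of j] n by linarith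
  then have sub: "PiE {1..d} (\<lambda>j. {1..r j}) \<subseteq> index_box d (\<lambda>_. n)"
    unfolding index_box_def by (intro PiE_mono) auto
  have "(\<Sum>x\<in>PiE {1..d} (\<lambda>j. {1..r j}). H x * (\<Prod>J\<in>P. diagonal J x))
      = (\<Sum>x\<in>PiE {1..d} (\<lambda>j. {1..r j}). \<Sum>i<k. H x * v i x)"
    using sub sum_u uv by (intro sum.cong) (auto simp: sum_distrib_left subset_iff)
  also have "\<dots> = 0" using H by (subst sum.swap) simp
  finally show False using H0 by simp
qed

section \<open>The block-diagonal tensor and its two ranks\<close>

theorem corollary1p6:
  fixes d n :: nat and R1 R2 :: "nat set set set"
  assumes "d \<ge> 2"
    and "partition_family d R1"
    and "partition_family d R2"
    and "\<not> family_finer d R2 R1"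
    and "n \<ge> 1"
  shows "\<exists>T :: 'a::field tensor.
           R_rank d (\<lambda>_. n) R2 T = 1 \<and>
           real (R_rank d (\<lambda>_. n) R1 T) \<ge> real n powr (3 powr (- (2 ^ (d + 1))))"
proof -
  have R1: "\<And>Q. Q \<in> R1 \<Longrightarrow> partition_on {1..d} Q"
    using assms(2) by (simp add: partition_family_def)
  obtain P where P: "P \<in> R2" "\<And>Q. Q \<in> R1 \<Longrightarrow> \<not> refines {1..d} P Q"
    using assms(4) unfolding family_finer_def by blast
  have part: "partition_on {1..d} P" using P(1) assms(3) by (simp add: partition_family_def)
  have notfiner: "\<exists>J\<in>P. \<forall>K\<in>Q. \<not> J \<subseteq> K" if "Q \<in> R1" for Q
    using P(2)[OF that] part R1[OF that] unfolding refines_def by blast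
  define T :: "'a tensor" where "T = (\<lambda>x. \<Prod>J\<in>P. diagonal J x)"
  have "T x = (\<Prod>J\<in>P. diagonal J (restrict x J))" for x
    by (simp add: T_def diagonal_def)
  then have rank_le: "R_rank_le_one d (\<lambda>_. n) R2 T"
    using P(1) unfolding R_rank_le_one_def by (intro bexI[of _ P] exI[of _ diagonal]) auto
  \<comment> \<open>A nonzero value inside the box excludes \<open>R2\<close>-rank 0; the all-ones
    point lies there because \<open>n\<close> is positive.\<close>
  have point: "restrict (\<lambda>_. 1) {1..d} \<in> index_box d (\<lambda>_. n)"
    using assms(5) by (auto simp: index_box_def)
  have nonzero: "T (restrict (\<lambda>_. 1) {1..d}) \<noteq> 0"
  proof -
    have "J \<subseteq> {1..d}" if "J \<in> P" for J using part that by (auto simp: partition_on_def)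
    then have "(diagonal J (restrict (\<lambda>_. 1 :: nat) {1..d}) :: 'a) = 1" if "J \<in> P" for J
      using that by (force simp: diagonal_def subset_iff)
    then show ?thesis by (simp add: T_def)
  qed
  have "R_rank d (\<lambda>_. n) R2 T = 1" using R_rank_eq_1[where T = T] rank_le point nonzero by blast
  moreover have "real (R_rank d (\<lambda>_. n) R1 T) \<ge> real n powr (3 powr (- (2 ^ (d + 1))))"
  proof (rule ccontr)
    define k where "k = R_rank d (\<lambda>_. n) R1 T"
    assume "\<not> ?thesis"
    \<comment> \<open>Written as the reciprocal of a natural number, the exponent can be cleared to
      give an inequality between naturals.\<close>
    then have "real k < real n powr (1 / real (3 ^ (2 ^ (d + 1))))"
      by (simp only: not_le k_def three_powr_minus_two_power)
    then have less: "k ^ (3 ^ (2 ^ (d + 1))) < n"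
      by (rule less_powr_inverse_power) simp
    have "\<exists>k. R_decomposable d (\<lambda>_. n) R1 T k"
      by (rule R_decomposable_ex) (use assms(1,2) in simp_all)
    then have "R_decomposable d (\<lambda>_. n) R1 T k"
      unfolding k_def R_rank_def by (rule LeastI_ex)
    then have "n \<le> k ^ ((d + 1) ^ d)"
      unfolding T_def by (intro diagonal_R_decomposable_lower_bound[OF part R1 notfiner])
    also have "\<dots> \<le> k ^ (3 ^ (2 ^ (d + 1)))"
      using exponent_bound[of d] by (intro power_increasing_nat) auto
    finally show False using less by simp
  qed
  ultimately show ?thesis by blast
qed

end
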